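(* Let $p$ be a polynomial with complex coefficients. Then there exists a non-constant entire function $f$ such that $f\circ p$ is even if and only if one of the following holds: (A) $p$ is even. (B) $p(z)=s(z)+k$, where $s$ is an odd polynomial and $k$ is a complex constant. (C) $p(z)=(s(z)+d)^{2}+k$, where $s$ is an odd polynomial and $d,k$ are complex constants with $d\neq 0$.
   Context: A function $h$ is even if $h(-z)=h(z)$ for all $z$, and odd if $h(-z)=-h(z)$ for all $z$; the zero function is both even and odd. *)

theory Defs
  imports "HOL-Complex_Analysis.Complex_Analysis"
begin

definition even_fun :: "(complex \<Rightarrow> complex) \<Rightarrow> bool" where
  "even_fun h \<longleftrightarrow> (\<forall>z. h (- z) = h z)"

definition odd_fun :: "(complex \<Rightarrow> complex) \<Rightarrow> bool" where
  "odd_fun h \<longleftrightarrow> (\<forall>z. h (- z) = - h z)"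

end

theory Submission
  imports Defs "HOL-Computational_Algebra.Fundamental_Theorem_Algebra"
begin

text \<open>
  If \<open>f \<circ> p\<close> is even and \<open>p z = w\<close>, then \<open>f\<close> takes the same value at \<open>w\<close> and at \<open>p (- z)\<close>. A
  non-constant entire \<open>f\<close> cannot repeat each value taken far out at a point of strictly smaller
  modulus, by Liouville's theorem. So it suffices to find, for all large \<open>w\<close>, such a descending move.

  Let \<open>n\<close> be the degree of \<open>p\<close>, normalised by \<open>p 0 = 0\<close>, and put
  \<open>r z = p (- z) - (-1)^n p z\<close>, of degree \<open>l < n\<close>. The solutions of
  \<open>p z = a \<zeta>^n\<close> are asymptotic to \<open>\<omega>^j \<zeta>\<close> with \<open>\<omega>\<close> a primitive \<open>n\<close>-th root of unity, hence they
  move \<open>w\<close> to \<open>\<plusminus>w + r z\<close> with displacement of direction \<open>\<omega>^(j l)\<close>. Unless \<open>\<omega>^l\<close> is real, i.e. \<open>n = 2 l\<close>,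
  some \<open>j\<close> makes the move descending.

  If \<open>n = 2 l\<close>, completing the square gives \<open>p = (S + d)^2 + k + E\<close> with \<open>S\<close> odd of odd degree
  \<open>l\<close> and \<open>E\<close> even of degree below \<open>2 l\<close>. Composing the moves along two solutions \<open>z\<close> and \<open>y\<close>
  with \<open>S z\<close> and \<open>- S y\<close> asymptotically equal cancels the main displacement and leaves one
  proportional to \<open>E y - E z\<close>, whose direction can again be chosen to descend unless \<open>E\<close> is constant.
\<close>

section \<open>Directions given by powers of a root of unity\<close>

text \<open>The numbers \<open>Re (X * \<mu> ^ j)\<close> have mean zero and mean square half of
  \<open>|X|^2\<close>, because the powers of \<open>\<mu>\<close> and of its square both sum to
  zero. Values with these two means cannot all exceed \<open>- |X| / 2\<close>. Cube roots of unity
  show that the bound is sharp; for \<open>\<mu> = - 1\<close> and imaginary \<open>X\<close> no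
  value would be negative.\<close>

lemma exists_root_of_unity_in_halfplane:
  fixes \<mu> X :: complex
  assumes N: "N > 0" and \<mu>N: "\<mu> ^ N = 1" and \<mu>2: "\<mu>\<^sup>2 \<noteq> 1"
  shows "\<exists>j<N. Re (X * \<mu> ^ j) \<le> - norm X / 2"
proof (rule ccontr)
  assume "\<not> ?thesis"
  then have lower: "Re (X * \<mu> ^ j) > - norm X / 2" if "j < N" for j
    using that by force
  have norm_\<mu>: "norm \<mu> = 1"
    using N \<mu>N power_eq_1_iff by blast
  have "\<mu> \<noteq> 1"
    using \<mu>2 by auto
  then have sum1: "(\<Sum>j<N. \<mu> ^ j) = 0"
    using \<mu>N by (simp add: geometric_sum)
  have "(\<mu>\<^sup>2) ^ N = 1"
    by (metis \<mu>N mult.commute power_mult power_one)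
  then have sum2: "(\<Sum>j<N. (\<mu>\<^sup>2) ^ j) = 0"
    using \<mu>2 by (simp add: geometric_sum)
  define t where "t j = Re (X * \<mu> ^ j)" for j
  have "(\<Sum>j<N. t j) = Re (X * (\<Sum>j<N. \<mu> ^ j))"
    by (simp add: t_def sum_distrib_left)
  then have St: "(\<Sum>j<N. t j) = 0"
    by (simp add: sum1)
  have Re_sq: "(Re z)\<^sup>2 = ((norm z)\<^sup>2 + Re (z\<^sup>2)) / 2" for z
    by (simp only: cmod_power2) (simp add: power2_eq_square)
  have "(t j)\<^sup>2 = (norm X)\<^sup>2 / 2 + Re (X\<^sup>2 * (\<mu>\<^sup>2) ^ j) / 2" for j
    unfolding t_def Re_sq
    by (simp add: norm_mult norm_power norm_\<mu> power_mult_distrib add_divide_distrib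
        flip: power_mult) (simp add: mult.commute)
  then have "(\<Sum>j<N. (t j)\<^sup>2) = N * (norm X)\<^sup>2 / 2 + Re (X\<^sup>2 * (\<Sum>j<N. (\<mu>\<^sup>2) ^ j)) / 2"
    by (simp add: sum.distrib sum_distrib_left flip: sum_divide_distrib)
  then have St2: "(\<Sum>j<N. (t j)\<^sup>2) = N * (norm X)\<^sup>2 / 2"
    by (simp add: sum2)
  txt \<open>Since \<open>(t + |X|/2)(|X| - t)\<close> is nonnegative at every \<open>t j\<close> but sums to zero, every \<open>t j\<close> equals \<open>|X|\<close>.\<close>
  have upper: "t j \<le> norm X" for j
    using complex_Re_le_cmod[of "X * \<mu> ^ j"] by (simp add: t_def norm_mult norm_power norm_\<mu>)
  have "(\<Sum>j<N. (t j + norm X / 2) * (norm X - t j))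
      = (\<Sum>j<N. norm X / 2 * t j - (t j)\<^sup>2 + (norm X)\<^sup>2 / 2)"
    by (rule sum.cong) (auto simp: field_simps power2_eq_square)
  also have "\<dots> = norm X / 2 * (\<Sum>j<N. t j) - (\<Sum>j<N. (t j)\<^sup>2) + N * ((norm X)\<^sup>2 / 2)"
    by (simp add: sum.distrib sum_subtractf sum_distrib_left)
  also have "\<dots> = 0"
    by (simp add: St St2)
  finally have S0: "(\<Sum>j<N. (t j + norm X / 2) * (norm X - t j)) = 0" .
  have "(t j + norm X / 2) * (norm X - t j) \<ge> 0" if "j < N" for j
    using lower[OF that] upper[of j] by (intro mult_nonneg_nonneg) (auto simp: t_def)
  then have "(t j + norm X / 2) * (norm X - t j) = 0" if "j < N" for j
    using S0 that by (subst (asm) sum_nonneg_eq_0_iff) auto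
  then have "t j = norm X" if "j < N" for j
    using lower[OF that] that unfolding t_def by fastforce
  then have "(\<Sum>j<N. t j) = N * norm X"
    by simp
  then have "norm X = 0"
    using St N by simp
  then show False
    using lower[OF N] by simp
qed

section \<open>Descending moves force constancy\<close>

text \<open>Each level set of \<open>f\<close> is closed and so has a point of least modulus. No
  descent is possible from there, so this point lies in a fixed disc. Hence all values of
  \<open>f\<close> are taken on a compact set, and Liouville's theorem applies.\<close>

lemma constant_if_descending:
  fixes f :: "complex \<Rightarrow> complex"
  assumes f: "f holomorphic_on UNIV"
    and desc: "\<forall>\<^sub>F w in at_infinity. \<exists>w'. norm w' < norm w \<and> f w' = f w"
  shows "f constant_on UNIV"
proof -
  obtain B where B: "\<And>w. norm w \<ge> B \<Longrightarrow> \<exists>w'. norm w' < norm w \<and> f w' = f w"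
    using desc by (auto simp: eventually_at_infinity)
  have cont: "continuous_on UNIV f"
    using f holomorphic_on_imp_continuous_on by blast
  have "f w \<in> f ` cball 0 B" for w
  proof -
    have "closed {v. f v = f w}"
      using cont by (intro closed_Collect_eq) auto
    then obtain v where v: "f v = f w" "\<And>y. f y = f w \<Longrightarrow> norm v \<le> norm y"
      using distance_attains_inf[of "{v. f v = f w}" 0] by auto
    then have "norm v < B"
      using B[of v] by fastforce
    then show ?thesis
      using v(1) by (metis image_eqI less_imp_le mem_cball_0)
  qed
  moreover have "bounded (f ` cball 0 B)"
    by (meson compact_cball compact_continuous_image compact_imp_bounded cont
        continuous_on_subset subset_UNIV)
  ultimately have "bounded (range f)"
    by (meson bounded_subset image_subsetI)
  then show ?thesis
    using f Liouville_theorem by blast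
qed

text \<open>With \<open>w = a * \<zeta> ^ n\<close> and \<open>\<theta> = 1 / \<zeta> ^ N\<close>,
  the assumption \<open>asym\<close> says
  \<open>s * v k \<zeta> / w = 1 + K k * \<theta> + o(\<theta>)\<close>. The unimodular
  \<open>s\<close> covers moves asymptotic to a rotated \<open>w\<close>. By \<open>dir\<close> some
  \<open>k\<close> makes the first-order term reduce the modulus by a definite fraction of
  \<open>|\<theta>|\<close>, whatever the argument of \<open>\<theta>\<close>.\<close>

lemma constant_if_asymptotically_descending:
  fixes f :: "complex \<Rightarrow> complex" and v :: "'k \<Rightarrow> complex \<Rightarrow> complex"
  assumes f: "f holomorphic_on UNIV" and a: "a \<noteq> 0" and n: "n > 0" and N: "N > 0"
    and J: "finite J" and s: "norm s = 1" and C: "C > 0"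
    and inv: "\<And>k \<zeta>. k \<in> J \<Longrightarrow> f (v k \<zeta>) = f (a * \<zeta> ^ n)"
    and asym: "\<And>k. k \<in> J \<Longrightarrow>
      ((\<lambda>\<zeta>. (s * v k \<zeta> / (a * \<zeta> ^ n) - 1) * \<zeta> ^ N) \<longlongrightarrow> K k) at_infinity"
    and dir: "\<And>\<theta>. \<exists>k\<in>J. Re (K k * \<theta>) \<le> - C * norm \<theta>"
  shows "f constant_on UNIV"
proof -
  define x where "x k \<zeta> = s * v k \<zeta> / (a * \<zeta> ^ n) - 1" for k \<zeta>
  \<comment> \<open>\<open>M * |\<theta>|\<close> will bound \<open>|x k \<zeta>|\<close> for all
    \<open>k\<close> at once, the summand \<open>C / 2\<close> covering the error term. Once
    \<open>|\<theta>| < C / M^2\<close>, the quadratic term of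
    \<open>|1 + x|^2 = 1 + 2 Re x + |x|^2\<close> is outweighed by the linear one.\<close>
  define M where "M = (\<Sum>k\<in>J. norm (K k)) + C / 2"
  have M: "M > 0"
    using C by (simp add: M_def add_nonneg_pos sum_nonneg)
  have "\<forall>\<^sub>F \<zeta> in at_infinity. \<forall>k\<in>J. dist (x k \<zeta> * \<zeta> ^ N) (K k) < C / 2"
    using asym C unfolding x_def
    by (intro eventually_ball_finite J ballI tendstoD) auto
  moreover have "((\<lambda>\<zeta>::complex. inverse (\<zeta> ^ N)) \<longlongrightarrow> 0) at_infinity"
    using N by (intro filterlim_compose[OF tendsto_inverse_0] filterlim_power_at_infinity) auto
  then have "\<forall>\<^sub>F \<zeta>::complex in at_infinity. dist (inverse (\<zeta> ^ N)) 0 < C / M\<^sup>2"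
    using C M by (intro tendstoD) auto
  moreover have "\<forall>\<^sub>F \<zeta>::complex in at_infinity. \<zeta> \<noteq> 0"
    by (rule eventually_not_equal_at_infinity)
  ultimately have "\<forall>\<^sub>F \<zeta> in at_infinity. \<exists>w'. norm w' < norm (a * \<zeta> ^ n) \<and> f w' = f (a * \<zeta> ^ n)"
  proof eventually_elim
    case (elim \<zeta>)
    define \<theta> where "\<theta> = inverse (\<zeta> ^ N)"
    have \<theta>: "\<theta> \<noteq> 0" "norm \<theta> < C / M\<^sup>2" "\<theta> * \<zeta> ^ N = 1"
      using elim by (auto simp: \<theta>_def)
    obtain k where k: "k \<in> J" "Re (K k * \<theta>) \<le> - C * norm \<theta>"
      using dir by blast
    have "x k \<zeta> - K k * \<theta> = (x k \<zeta> * \<zeta> ^ N - K k) * \<theta>"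
      using \<theta>(3) by (simp add: algebra_simps)
    then have "norm (x k \<zeta> - K k * \<theta>) = norm (x k \<zeta> * \<zeta> ^ N - K k) * norm \<theta>"
      by (simp add: norm_mult)
    also have "\<dots> \<le> C / 2 * norm \<theta>"
      using elim(1) k(1) by (intro mult_right_mono) (auto simp: dist_norm less_imp_le)
    finally have diff: "norm (x k \<zeta> - K k * \<theta>) \<le> C / 2 * norm \<theta>" .
    then have Re_x: "Re (x k \<zeta>) \<le> - (C / 2) * norm \<theta>"
      using k(2) complex_Re_le_cmod[of "x k \<zeta> - K k * \<theta>"] by simp
    have "norm (K k) \<le> (\<Sum>k\<in>J. norm (K k))"
      using k(1) J by (intro member_le_sum[where f = "\<lambda>k. norm (K k)"]) auto
    then have "norm (K k * \<theta>) \<le> (\<Sum>k\<in>J. norm (K k)) * norm \<theta>"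
      by (simp add: norm_mult mult_right_mono)
    then have "norm (x k \<zeta>) \<le> M * norm \<theta>"
      using diff norm_triangle_sub[of "x k \<zeta>" "K k * \<theta>"] by (simp add: M_def algebra_simps)
    then have "(norm (x k \<zeta>))\<^sup>2 \<le> M\<^sup>2 * norm \<theta> * norm \<theta>"
      by (metis mult.assoc norm_ge_zero power2_eq_square power_mono power_mult_distrib)
    also have "\<dots> < C * norm \<theta>"
      using \<theta> M by (intro mult_strict_right_mono) (auto simp: field_simps)
    finally have norm_x: "(norm (x k \<zeta>))\<^sup>2 < C * norm \<theta>" .
    have "(norm (1 + x k \<zeta>))\<^sup>2 = 1 + 2 * Re (x k \<zeta>) + (norm (x k \<zeta>))\<^sup>2"
      by (simp only: cmod_power2) (simp add: power2_eq_square algebra_simps)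
    also have "\<dots> < 1"
      using Re_x norm_x by simp
    finally have "norm (1 + x k \<zeta>) < 1"
      by (simp add: power_less_one_iff abs_square_less_1)
    moreover have "s * v k \<zeta> = (1 + x k \<zeta>) * (a * \<zeta> ^ n)"
      using a elim(3) by (simp add: x_def)
    then have "norm (v k \<zeta>) = norm (1 + x k \<zeta>) * norm (a * \<zeta> ^ n)"
      by (metis mult_1 norm_mult s)
    ultimately have "norm (v k \<zeta>) < norm (a * \<zeta> ^ n)"
      using a elim(3) by simp
    then show ?case
      using inv k(1) by blast
  qed
  then obtain B where B: "\<And>\<zeta>. norm \<zeta> \<ge> B \<Longrightarrow>
      \<exists>w'. norm w' < norm (a * \<zeta> ^ n) \<and> f w' = f (a * \<zeta> ^ n)"
    by (auto simp: eventually_at_infinity)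
  \<comment> \<open>Every \<open>w\<close> has the form \<open>a * \<zeta> ^ n\<close>. The absolute
    value of \<open>B\<close> keeps the comparison of powers valid for negative
    \<open>B\<close>.\<close>
  have "\<exists>w'. norm w' < norm w \<and> f w' = f w" if w: "norm w \<ge> norm a * \<bar>B\<bar> ^ n" for w
  proof -
    obtain \<zeta> where \<zeta>: "\<zeta> ^ n = w / a"
      using n nth_root_exists[of n "w / a"] by blast
    then have "norm w = norm a * norm \<zeta> ^ n"
      using a by (simp flip: norm_power norm_mult)
    then have "norm \<zeta> ^ n \<ge> \<bar>B\<bar> ^ n"
      using w a by simp
    then have "norm \<zeta> \<ge> B"
      by (metis abs_le_D1 n norm_ge_zero power_mono_iff abs_ge_zero order.trans abs_ge_self)
    then show ?thesis
      using B[of \<zeta>] \<zeta> a by simp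
  qed
  then show ?thesis
    by (intro constant_if_descending[OF f]) (auto simp: eventually_at_infinity)
qed

section \<open>Asymptotics of polynomials and of their preimages\<close>

lemma prod_mset_ge_power:
  fixes g :: "'a \<Rightarrow> real"
  assumes "c \<ge> 0" "\<And>x. x \<in># A \<Longrightarrow> g x \<ge> c"
  shows "c ^ size A \<le> (\<Prod>x\<in>#A. g x)"
  using assms(2)
proof (induction A)
  case (add x A)
  then have "c * c ^ size A \<le> g x * (\<Prod>x\<in>#A. g x)"
    using assms(1) by (intro mult_mono) (auto intro: order_trans)
  then show ?case
    by simp
qed simp

text \<open>Factor \<open>p - w\<close> over its roots and take for \<open>z\<close> the root
  nearest to \<open>y\<close>: each factor of the product at \<open>y\<close> then has modulus at
  least \<open>|y - z|\<close>.\<close>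

lemma exists_preimage_near:
  fixes p :: "complex poly"
  assumes deg: "degree p > 0"
  shows "\<exists>z. poly p z = w \<and> norm (lead_coeff p) * norm (y - z) ^ degree p \<le> norm (poly p y - w)"
proof -
  define q where "q = p - [:w:]"
  have deg_q: "degree q = degree p"
    using deg unfolding q_def diff_conv_add_uminus
    by (intro degree_add_eq_left) simp
  then have "lead_coeff q = lead_coeff p"
    using deg by (simp add: q_def coeff_pCons split: nat.splits)
  moreover have "q \<noteq> 0"
    using deg deg_q by auto
  ultimately obtain A where A: "size A = degree p" "q = smult (lead_coeff p) (\<Prod>x\<in>#A. [:-x, 1:])"
    using alg_closed_imp_factorization[of q] deg_q by auto
  have q_eq: "poly q u = lead_coeff p * (\<Prod>x\<in>#A. u - x)" for u
    by (subst A(2)) (simp add: poly_prod_mset image_mset.compositionality o_def)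
  define z where "z = arg_min_on (\<lambda>x. norm (y - x)) (set_mset A)"
  have A_ne: "set_mset A \<noteq> {}"
    using A(1) deg by auto
  have zA: "z \<in># A"
    unfolding z_def using A_ne by (intro arg_min_if_finite(1)) auto
  have z_min: "norm (y - z) \<le> norm (y - x)" if "x \<in># A" for x
    unfolding z_def using that A_ne by (intro arg_min_least) auto
  have "poly q z = 0"
    using zA by (simp add: q_eq prod_mset_zero_iff)
  then have "poly p z = w"
    by (simp add: q_def)
  moreover have "norm (y - z) ^ size A \<le> (\<Prod>x\<in>#A. norm (y - x))"
    using z_min by (intro prod_mset_ge_power) auto
  moreover have "norm (\<Prod>x\<in>#A. y - x) = (\<Prod>x\<in>#A. norm (y - x))"
    by (induction A) (auto simp: norm_mult)
  then have "norm (poly p y - w) = norm (lead_coeff p) * (\<Prod>x\<in>#A. norm (y - x))"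
    using q_eq[of y] by (simp add: q_def norm_mult)
  ultimately show ?thesis
    using A(1) by (metis mult_left_mono norm_ge_zero)
qed

lemma poly_asymptotics:
  fixes r :: "complex poly"
  assumes z: "((\<lambda>\<zeta>. z \<zeta> / \<zeta>) \<longlongrightarrow> c) at_infinity" and deg: "degree r \<le> l"
  shows "((\<lambda>\<zeta>. poly r (z \<zeta>) / \<zeta> ^ l) \<longlongrightarrow> coeff r l * c ^ l) at_infinity"
proof -
  have lim: "((\<lambda>\<zeta>. z \<zeta> ^ i / \<zeta> ^ l) \<longlongrightarrow> (if i = l then c ^ l else 0)) at_infinity" if "i \<le> l" for i
  proof -
    \<comment> \<open>Since \<open>0 ^ 0 = 1\<close>, this limit treats \<open>i = l\<close> and
      \<open>i < l\<close> together.\<close>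
    have "((\<lambda>\<zeta>. (z \<zeta> / \<zeta>) ^ i * inverse \<zeta> ^ (l - i)) \<longlongrightarrow> c ^ i * 0 ^ (l - i)) at_infinity"
      by (intro tendsto_intros z tendsto_inverse_0)
    moreover have "\<forall>\<^sub>F \<zeta>::complex in at_infinity.
        (z \<zeta> / \<zeta>) ^ i * inverse \<zeta> ^ (l - i) = z \<zeta> ^ i / \<zeta> ^ l"
      using eventually_not_equal_at_infinity[of 0]
    proof eventually_elim
      case (elim \<zeta>)
      have "\<zeta> ^ l = \<zeta> ^ i * \<zeta> ^ (l - i)"
        using that by (simp flip: power_add)
      then show ?case
        by (simp add: field_simps)
    qed
    moreover have "c ^ i * 0 ^ (l - i) = (if i = l then c ^ l else 0)"
      using that by auto
    ultimately show ?thesis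
      by (simp add: tendsto_cong)
  qed
  have "((\<lambda>\<zeta>. \<Sum>i\<le>l. coeff r i * (z \<zeta> ^ i / \<zeta> ^ l))
      \<longlongrightarrow> (\<Sum>i\<le>l. coeff r i * (if i = l then c ^ l else 0))) at_infinity"
    by (intro tendsto_sum tendsto_mult tendsto_const lim) auto
  moreover have "(\<Sum>i\<le>l. coeff r i * (if i = l then c ^ l else 0)) = coeff r l * c ^ l"
    by (simp add: if_distrib cong: if_cong)
  moreover have "(\<Sum>i\<le>l. coeff r i * (z \<zeta> ^ i / \<zeta> ^ l)) = poly r (z \<zeta>) / \<zeta> ^ l" for \<zeta>
  proof -
    have "poly r (z \<zeta>) = (\<Sum>i\<le>l. coeff r i * z \<zeta> ^ i)"
      unfolding poly_altdef using deg by (intro sum.mono_neutral_left) (auto simp: coeff_eq_0)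
    then show ?thesis
      by (simp add: sum_divide_distrib)
  qed
  ultimately show ?thesis
    by simp
qed

text \<open>The number \<open>c\<close> selects the branch. Since
  \<open>poly p (c * \<zeta>)\<close> and \<open>w \<zeta>\<close> agree up to
  \<open>o(\<zeta>^n)\<close>, where \<open>n\<close> is the degree, the solution near
  \<open>c * \<zeta>\<close> differs from it by \<open>o(\<zeta>)\<close>.\<close>

lemma exists_asymptotic_preimage:
  fixes p :: "complex poly" and w :: "complex \<Rightarrow> complex"
  assumes deg: "degree p > 0"
    and w: "((\<lambda>\<zeta>. w \<zeta> / \<zeta> ^ degree p) \<longlongrightarrow> lead_coeff p * c ^ degree p) at_infinity"
  obtains z where "\<And>\<zeta>. poly p (z \<zeta>) = w \<zeta>" "((\<lambda>\<zeta>. z \<zeta> / \<zeta>) \<longlongrightarrow> c) at_infinity"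
proof -
  define n where "n = degree p"
  define a where "a = lead_coeff p"
  have a: "a \<noteq> 0"
    using deg by (auto simp: a_def)
  obtain z where z: "\<And>\<zeta>. poly p (z \<zeta>) = w \<zeta>"
      "\<And>\<zeta>. norm a * norm (c * \<zeta> - z \<zeta>) ^ n \<le> norm (poly p (c * \<zeta>) - w \<zeta>)"
  proof -
    have "\<forall>\<zeta>. \<exists>z. poly p z = w \<zeta> \<and> norm a * norm (c * \<zeta> - z) ^ n \<le> norm (poly p (c * \<zeta>) - w \<zeta>)"
      using exists_preimage_near[OF deg] unfolding a_def n_def by blast
    then show thesis
      using that by metis
  qed
  have "((\<lambda>\<zeta>. c * \<zeta> / \<zeta>) \<longlongrightarrow> c) at_infinity"
    by (intro tendsto_eventually eventually_mono[OF eventually_not_equal_at_infinity[of 0]]) simp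
  then have "((\<lambda>\<zeta>. poly p (c * \<zeta>) / \<zeta> ^ n) \<longlongrightarrow> a * c ^ n) at_infinity"
    unfolding a_def n_def by (rule poly_asymptotics) simp
  then have "((\<lambda>\<zeta>. poly p (c * \<zeta>) / \<zeta> ^ n - w \<zeta> / \<zeta> ^ n) \<longlongrightarrow> a * c ^ n - a * c ^ n) at_infinity"
    using w unfolding a_def n_def by (intro tendsto_diff) auto
  then have "((\<lambda>\<zeta>. norm (poly p (c * \<zeta>) / \<zeta> ^ n - w \<zeta> / \<zeta> ^ n)) \<longlongrightarrow> 0) at_infinity"
    by (intro tendsto_norm_zero) simp
  then have lim: "((\<lambda>\<zeta>. norm (poly p (c * \<zeta>) / \<zeta> ^ n - w \<zeta> / \<zeta> ^ n) / norm a) \<longlongrightarrow> 0) at_infinity"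
    by (rule tendsto_divide_zero)
  have le: "\<forall>\<^sub>F \<zeta> in at_infinity. norm (c - z \<zeta> / \<zeta>) ^ n
      \<le> norm (poly p (c * \<zeta>) / \<zeta> ^ n - w \<zeta> / \<zeta> ^ n) / norm a"
    using eventually_not_equal_at_infinity[of 0]
  proof eventually_elim
    case (elim \<zeta>)
    have "c - z \<zeta> / \<zeta> = (c * \<zeta> - z \<zeta>) / \<zeta>"
      using elim by (simp add: field_simps)
    then have "norm (c - z \<zeta> / \<zeta>) ^ n = norm (c * \<zeta> - z \<zeta>) ^ n / norm \<zeta> ^ n"
      by (simp add: norm_divide power_divide)
    also have "\<dots> \<le> norm (poly p (c * \<zeta>) - w \<zeta>) / norm a / norm \<zeta> ^ n"
      using z(2)[of \<zeta>] a by (intro divide_right_mono) (auto simp: field_simps)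
    also have "\<dots> = norm (poly p (c * \<zeta>) / \<zeta> ^ n - w \<zeta> / \<zeta> ^ n) / norm a"
      unfolding diff_divide_distrib[symmetric] by (simp add: norm_divide norm_power)
    finally show ?case .
  qed
  have "((\<lambda>\<zeta>. norm (c - z \<zeta> / \<zeta>) ^ n) \<longlongrightarrow> 0) at_infinity"
    by (rule tendsto_sandwich[OF _ le tendsto_const lim]) auto
  then have "((\<lambda>\<zeta>. root n (norm (c - z \<zeta> / \<zeta>) ^ n)) \<longlongrightarrow> root n 0) at_infinity"
    by (intro tendsto_real_root)
  then have "((\<lambda>\<zeta>. norm (c - z \<zeta> / \<zeta>)) \<longlongrightarrow> 0) at_infinity"
    using deg by (simp add: n_def real_root_power_cancel)
  then have "((\<lambda>\<zeta>. z \<zeta> / \<zeta>) \<longlongrightarrow> c) at_infinity"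
    by (subst tendsto_dist_iff) (simp only: dist_norm norm_minus_commute)
  then show ?thesis
    using z(1) that by blast
qed

section \<open>The degree of the parity defect\<close>

lemma primitive_root_of_unity_exists:
  assumes "n > 0"
  obtains \<omega> :: complex where "\<And>k. \<omega> ^ k = 1 \<longleftrightarrow> n dvd k"
proof
  fix k :: nat
  show "exp (2 * of_real pi * \<i> / of_nat n) ^ k = 1 \<longleftrightarrow> n dvd k"
    using complex_root_unity_eq_1[of n k] assms
    by (simp add: mult.commute mult.left_commute flip: exp_of_nat_mult)
qed

text \<open>A single move \<open>p z\<close> to \<open>p (- z)\<close> along one of the
  \<open>n\<close> branches already descends unless \<open>\<omega> ^ l\<close> is real, where
  \<open>l\<close> is the degree of \<open>r\<close>. For \<open>0 < l < n\<close> this leaves only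
  \<open>2 * l = n\<close>.\<close>

lemma degree_parity_defect:
  fixes p r :: "complex poly"
  assumes f: "f holomorphic_on UNIV" and nonconst: "\<not> f constant_on UNIV"
    and even: "\<And>z. f (poly p (- z)) = f (poly p z)"
    and r: "\<And>z. poly p (- z) = \<alpha> * poly p z + poly r z" and \<alpha>: "norm \<alpha> = 1"
    and deg: "0 < degree r" "degree r < degree p"
  shows "2 * degree r = degree p"
proof (rule ccontr)
  assume ne: "2 * degree r \<noteq> degree p"
  define n l a c where "n = degree p" and "l = degree r" and "a = lead_coeff p" and "c = lead_coeff r"
  have nl: "0 < l" "l < n" "n > 0"
    using deg by (auto simp: n_def l_def)
  have a: "a \<noteq> 0" and c: "c \<noteq> 0"
    using deg by (auto simp: a_def c_def)
  have \<alpha>0: "\<alpha> \<noteq> 0"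
    using \<alpha> by auto
  obtain \<omega> :: complex where \<omega>: "\<And>k. \<omega> ^ k = 1 \<longleftrightarrow> n dvd k"
    using primitive_root_of_unity_exists nl by blast
  have \<omega>l2: "(\<omega> ^ l)\<^sup>2 \<noteq> 1"
  proof
    assume "(\<omega> ^ l)\<^sup>2 = 1"
    then have "n dvd 2 * l"
      using \<omega>[of "2 * l"] by (simp add: power_mult mult.commute)
    then obtain m where m: "2 * l = n * m"
      by auto
    then have "n * 0 < n * m" "n * m < n * 2"
      using nl by linarith+
    then have "m = 1"
      by simp
    then show False
      using m ne by (simp add: n_def l_def)
  qed
  have \<omega>ln: "(\<omega> ^ l) ^ n = 1"
    using \<omega>[of "l * n"] by (simp add: power_mult)
  have "\<exists>z. (\<forall>\<zeta>. poly p (z \<zeta>) = a * \<zeta> ^ n) \<and> ((\<lambda>\<zeta>. z \<zeta> / \<zeta>) \<longlongrightarrow> \<omega> ^ j) at_infinity" for j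
  proof -
    have "(\<omega> ^ j) ^ n = 1"
      using \<omega>[of "j * n"] by (simp add: power_mult)
    then have "((\<lambda>\<zeta>. a * \<zeta> ^ n / \<zeta> ^ n) \<longlongrightarrow> a * (\<omega> ^ j) ^ n) at_infinity"
      by (intro tendsto_eventually eventually_mono[OF eventually_not_equal_at_infinity[of 0]]) simp
    then show ?thesis
      using exists_asymptotic_preimage[of p "\<lambda>\<zeta>. a * \<zeta> ^ n" "\<omega> ^ j"] nl
      unfolding n_def a_def by metis
  qed
  then obtain z where z: "\<And>j \<zeta>. poly p (z j \<zeta>) = a * \<zeta> ^ n"
      and z_lim: "\<And>j. ((\<lambda>\<zeta>. z j \<zeta> / \<zeta>) \<longlongrightarrow> \<omega> ^ j) at_infinity"
    by metis
  \<comment> \<open>After division by \<open>\<alpha> * a * \<zeta> ^ n\<close> the displacement is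
    \<open>r (z j \<zeta>)\<close>, asymptotic to
    \<open>c * \<omega> ^ (j * l) * \<zeta> ^ l\<close>, over that same denominator.\<close>
  define K where "K j = c / (\<alpha> * a) * (\<omega> ^ l) ^ j" for j :: nat
  have "f constant_on UNIV"
  proof (rule constant_if_asymptotically_descending
      [where J = "{..<n}" and v = "\<lambda>j \<zeta>. poly p (- z j \<zeta>)" and K = K and s = "inverse \<alpha>"
        and N = "n - l" and n = n and a = a and C = "norm (c / (\<alpha> * a)) / 2"])
    show "norm (c / (\<alpha> * a)) / 2 > 0"
      using a c \<alpha>0 by simp
    show "f (poly p (- z j \<zeta>)) = f (a * \<zeta> ^ n)" for j \<zeta>
      using even z by simp
    show "\<exists>j\<in>{..<n}. Re (K j * \<theta>) \<le> - (norm (c / (\<alpha> * a)) / 2) * norm \<theta>" for \<theta>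
    proof -
      obtain j where "j < n" "Re (c / (\<alpha> * a) * \<theta> * (\<omega> ^ l) ^ j) \<le> - norm (c / (\<alpha> * a) * \<theta>) / 2"
        using exists_root_of_unity_in_halfplane[OF \<open>n > 0\<close> \<omega>ln \<omega>l2] by blast
      moreover have "K j * \<theta> = c / (\<alpha> * a) * \<theta> * (\<omega> ^ l) ^ j"
        by (simp add: K_def)
      ultimately have "Re (K j * \<theta>) \<le> - (norm (c / (\<alpha> * a)) / 2) * norm \<theta>"
        unfolding norm_mult[of "c / (\<alpha> * a)" \<theta>] by simp
      then show ?thesis
        using \<open>j < n\<close> by blast
    qed
    show "((\<lambda>\<zeta>. (inverse \<alpha> * poly p (- z j \<zeta>) / (a * \<zeta> ^ n) - 1) * \<zeta> ^ (n - l)) \<longlongrightarrow> K j) at_infinity"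
      for j
    proof (rule tendsto_cong[THEN iffD1])
      show "((\<lambda>\<zeta>. poly r (z j \<zeta>) / \<zeta> ^ l / (\<alpha> * a)) \<longlongrightarrow> K j) at_infinity"
        using tendsto_divide[OF poly_asymptotics[OF z_lim[of j], of r l] tendsto_const, of "\<alpha> * a"] a \<alpha>0
        by (simp add: K_def l_def c_def mult.commute flip: power_mult)
      show "\<forall>\<^sub>F \<zeta> in at_infinity. poly r (z j \<zeta>) / \<zeta> ^ l / (\<alpha> * a)
          = (inverse \<alpha> * poly p (- z j \<zeta>) / (a * \<zeta> ^ n) - 1) * \<zeta> ^ (n - l)"
        using eventually_not_equal_at_infinity[of 0]
      proof eventually_elim
        case (elim \<zeta>)
        have "\<zeta> ^ n = \<zeta> ^ l * \<zeta> ^ (n - l)"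
          using nl by (simp flip: power_add)
        then show ?case
          unfolding r z using elim a \<alpha>0 by (simp add: field_simps)
      qed
    qed
  qed (use nl a \<alpha> f in \<open>auto simp: norm_inverse\<close>)
  then show False
    using nonconst by blast
qed

section \<open>Perturbed squares and composed moves\<close>

text \<open>Here the defect is \<open>- 4 * d * S\<close>, of half the degree of \<open>p\<close>,
  so a single move need not descend. The composed move goes from \<open>p z\<close> to
  \<open>p (- z) = p y\<close> and on to \<open>p (- y)\<close>, with total displacement
  \<open>- 4 * d * (S z + S y)\<close>. The relation between \<open>y\<close> and \<open>z\<close>
  expresses this sum through \<open>E y - E z\<close>.\<close>

lemma constant_if_square_perturbed:
  fixes p S E :: "complex poly"
  assumes f: "f holomorphic_on UNIV"
    and even: "\<And>z. f (poly p (- z)) = f (poly p z)"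
    and p: "\<And>z. poly p z = (poly S z + d)\<^sup>2 + poly E z" and d: "d \<noteq> 0"
    and S: "\<And>z. poly S (- z) = - poly S z" "odd (degree S)"
    and E: "\<And>z. poly E (- z) = poly E z" "even (degree E)"
    and deg: "degree p = 2 * degree S" "0 < degree E" "degree E < 2 * degree S"
  shows "f constant_on UNIV"
proof -
  define l e a b \<epsilon> where "l = degree S" and "e = degree E" and "a = lead_coeff p"
    and "b = lead_coeff S" and "\<epsilon> = lead_coeff E"
  have le: "l > 0" "e < 2 * l" "odd l" "even e" "e > 0" "degree p = 2 * l" "degree p > 0"
    using deg S(2) E(2) by (auto simp: l_def e_def)
  have "p \<noteq> 0" "S \<noteq> 0" "E \<noteq> 0"
    using le(7) deg(2) S(2) by auto
  then have a: "a \<noteq> 0" and b: "b \<noteq> 0" and \<epsilon>: "\<epsilon> \<noteq> 0"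
    by (simp_all only: a_def b_def \<epsilon>_def leading_coeff_0_iff not_False_eq_True)
  \<comment> \<open>Roots of order \<open>l\<close>, not \<open>2 * l\<close>, give all branches
    \<open>z i\<close> the same asymptotics \<open>b * \<zeta> ^ l\<close> of \<open>S\<close>. The
    branches of \<open>y\<close> start from \<open>- (\<eta> ^ j)\<close>, which reverses the sign
    because \<open>l\<close> is odd.\<close>
  obtain \<eta> :: complex where \<eta>: "\<And>k. \<eta> ^ k = 1 \<longleftrightarrow> l dvd k"
    using primitive_root_of_unity_exists le by blast
  define \<mu> where "\<mu> = \<eta> ^ e"
  \<comment> \<open>Otherwise \<open>l\<close> divides \<open>2 * e\<close>, hence \<open>e\<close>
    as \<open>l\<close> is odd. Then \<open>0 < e < 2 * l\<close> leaves only \<open>e = l\<close>,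
    excluded by parity.\<close>
  have "\<mu>\<^sup>2 \<noteq> 1"
  proof
    assume "\<mu>\<^sup>2 = 1"
    then have "l dvd e * 2"
      using \<eta>[of "e * 2"] by (simp add: \<mu>_def power_mult)
    then have "l dvd e"
      using le by (simp add: coprime_dvd_mult_left_iff)
    then obtain m where m: "e = l * m"
      by auto
    then have "l * 0 < l * m" "l * m < l * 2"
      using le by linarith+
    then have "m = 1"
      by simp
    then show False
      using m le by simp
  qed
  moreover have "\<mu> ^ l = 1"
    using \<eta>[of "e * l"] by (simp add: \<mu>_def power_mult)
  ultimately have halfplane: "\<exists>i<l. Re (X * \<mu> ^ i) \<le> - norm X / 2" for X
    using exists_root_of_unity_in_halfplane le by blast
  have \<eta>l: "(\<eta> ^ i) ^ l = 1" for i
    using \<eta>[of "i * l"] by (simp add: power_mult)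
  have \<eta>2l: "(\<eta> ^ i) ^ (2 * l) = 1" for i
    using \<eta>[of "i * (2 * l)"] by (simp add: power_mult)
  have "\<exists>z. (\<forall>\<zeta>. poly p (z \<zeta>) = a * \<zeta> ^ (2 * l)) \<and> ((\<lambda>\<zeta>. z \<zeta> / \<zeta>) \<longlongrightarrow> \<eta> ^ i) at_infinity" for i
  proof -
    have "((\<lambda>\<zeta>. a * \<zeta> ^ (2 * l) / \<zeta> ^ (2 * l)) \<longlongrightarrow> a * (\<eta> ^ i) ^ (2 * l)) at_infinity"
      unfolding \<eta>2l
      by (intro tendsto_eventually eventually_mono[OF eventually_not_equal_at_infinity[of 0]]) simp
    then show ?thesis
      using exists_asymptotic_preimage[of p "\<lambda>\<zeta>. a * \<zeta> ^ (2 * l)" "\<eta> ^ i"] le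
      unfolding a_def by metis
  qed
  then obtain z where z: "\<And>i \<zeta>. poly p (z i \<zeta>) = a * \<zeta> ^ (2 * l)"
      and z_lim: "\<And>i. ((\<lambda>\<zeta>. z i \<zeta> / \<zeta>) \<longlongrightarrow> \<eta> ^ i) at_infinity"
    by metis
  have "\<exists>y. (\<forall>\<zeta>. poly p (y \<zeta>) = poly p (- z i \<zeta>)) \<and> ((\<lambda>\<zeta>. y \<zeta> / \<zeta>) \<longlongrightarrow> - (\<eta> ^ j)) at_infinity"
    for i j
  proof -
    have "((\<lambda>\<zeta>. - z i \<zeta> / \<zeta>) \<longlongrightarrow> - (\<eta> ^ i)) at_infinity"
      using tendsto_minus[OF z_lim] by simp
    then have "((\<lambda>\<zeta>. poly p (- z i \<zeta>) / \<zeta> ^ (2 * l)) \<longlongrightarrow> a * (- (\<eta> ^ i)) ^ (2 * l)) at_infinity"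
      using poly_asymptotics[of "\<lambda>\<zeta>. - z i \<zeta>" "- (\<eta> ^ i)" p "2 * l"] le by (simp add: a_def)
    then have "((\<lambda>\<zeta>. poly p (- z i \<zeta>) / \<zeta> ^ (2 * l)) \<longlongrightarrow> a * (- (\<eta> ^ j)) ^ (2 * l)) at_infinity"
      by (simp add: \<eta>2l)
    then show ?thesis
      using exists_asymptotic_preimage[of p "\<lambda>\<zeta>. poly p (- z i \<zeta>)" "- (\<eta> ^ j)"] le
      unfolding a_def by metis
  qed
  then obtain y where y: "\<And>i j \<zeta>. poly p (y i j \<zeta>) = poly p (- z i \<zeta>)"
      and y_lim: "\<And>i j. ((\<lambda>\<zeta>. y i j \<zeta> / \<zeta>) \<longlongrightarrow> - (\<eta> ^ j)) at_infinity"
    by metis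
  \<comment> \<open>The displacement is \<open>- 4 * d * (E y - E z) / D\<close> with
    \<open>D\<close> asymptotic to \<open>2 * b * \<zeta> ^ l\<close>. Division by
    \<open>a * \<zeta> ^ (2 * l)\<close> yields the coefficient \<open>K\<close> and the exponent
    \<open>3 * l - e\<close>.\<close>
  define X where "X = 2 * d * \<epsilon> / (a * b)"
  define K where "K = (\<lambda>(i, j). X * (\<mu> ^ i - \<mu> ^ j))"
  show ?thesis
  proof (rule constant_if_asymptotically_descending
      [where J = "{..<l} \<times> {..<l}" and v = "\<lambda>(i, j) \<zeta>. poly p (- y i j \<zeta>)" and K = K and s = 1
        and N = "3 * l - e" and n = "2 * l" and a = a and C = "norm X"])
    show "norm X > 0"
      using a b d \<epsilon> by (simp add: X_def)
    show "f ((case k of (i, j) \<Rightarrow> \<lambda>\<zeta>. poly p (- y i j \<zeta>)) \<zeta>) = f (a * \<zeta> ^ (2 * l))" for k \<zeta>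
      by (auto simp: even y z split: prod.split)
    \<comment> \<open>The indices are chosen independently, \<open>i\<close> for
      \<open>X * \<theta>\<close> and \<open>j\<close> for its negative; each contributes half of
      the bound.\<close>
    show "\<exists>k\<in>{..<l} \<times> {..<l}. Re (K k * \<theta>) \<le> - norm X * norm \<theta>" for \<theta>
    proof -
      obtain i j where "i < l" "Re (X * \<theta> * \<mu> ^ i) \<le> - norm (X * \<theta>) / 2"
          and "j < l" "Re (- (X * \<theta>) * \<mu> ^ j) \<le> - norm (- (X * \<theta>)) / 2"
        using halfplane by metis
      moreover from this have "Re (K (i, j) * \<theta>) \<le> - norm X * norm \<theta>"
        by (simp add: K_def norm_mult algebra_simps)
      ultimately show ?thesis
        by auto
    qed
    fix k :: "nat \<times> nat"
    obtain i j where k: "k = (i, j)"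
      by fastforce
    have Sz: "((\<lambda>\<zeta>. poly S (z i \<zeta>) / \<zeta> ^ l) \<longlongrightarrow> b) at_infinity"
      using poly_asymptotics[OF z_lim[of i], of S l] unfolding \<eta>l by (simp add: l_def b_def)
    have "(- (\<eta> ^ j)) ^ l = - 1"
      using le(3) \<eta>l by simp
    then have Sy: "((\<lambda>\<zeta>. poly S (y i j \<zeta>) / \<zeta> ^ l) \<longlongrightarrow> - b) at_infinity"
      using poly_asymptotics[OF y_lim[of i j], of S l] by (simp add: l_def b_def)
    have Ez: "((\<lambda>\<zeta>. poly E (z i \<zeta>) / \<zeta> ^ e) \<longlongrightarrow> \<epsilon> * \<mu> ^ i) at_infinity"
      using poly_asymptotics[OF z_lim[of i], of E e]
      by (simp add: e_def \<epsilon>_def \<mu>_def mult.commute flip: power_mult)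
    have Ey: "((\<lambda>\<zeta>. poly E (y i j \<zeta>) / \<zeta> ^ e) \<longlongrightarrow> \<epsilon> * \<mu> ^ j) at_infinity"
      using poly_asymptotics[OF y_lim[of i j], of E e] le(4)
      by (simp add: e_def \<epsilon>_def \<mu>_def mult.commute flip: power_mult)
    \<comment> \<open>The equation \<open>p y = p (- z)\<close> equates \<open>E y - E z\<close>
      with a difference of two squares. Of its factors, \<open>S z + S y\<close> is the one where
      the leading terms cancel, and \<open>D\<close> is the other.\<close>
    define D where "D \<zeta> = poly S (z i \<zeta>) - poly S (y i j \<zeta>) - 2 * d" for \<zeta>
    have "((\<lambda>\<zeta>. poly S (z i \<zeta>) / \<zeta> ^ l - poly S (y i j \<zeta>) / \<zeta> ^ l - 2 * d * inverse \<zeta> ^ l)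
        \<longlongrightarrow> b - (- b) - 2 * d * 0 ^ l) at_infinity"
      by (intro tendsto_intros tendsto_inverse_0 Sz Sy)
    then have D_lim: "((\<lambda>\<zeta>. D \<zeta> / \<zeta> ^ l) \<longlongrightarrow> 2 * b) at_infinity"
      using le(1) by (simp add: D_def left_diff_distrib divide_inverse power_inverse power_0_left)
    then have D_ne: "\<forall>\<^sub>F \<zeta> in at_infinity. D \<zeta> / \<zeta> ^ l \<noteq> 0"
      using b by (intro tendsto_imp_eventually_ne[OF D_lim]) simp
    have neg: "poly p (- u) = poly p u - 4 * d * poly S u" for u
      by (simp add: p S E power2_eq_square algebra_simps)
    have defect: "poly p (- y i j \<zeta>) - a * \<zeta> ^ (2 * l)
        = - 4 * d * (poly S (z i \<zeta>) + poly S (y i j \<zeta>))" for \<zeta>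
      by (simp add: neg y z algebra_simps)
    have SD: "(poly S (z i \<zeta>) + poly S (y i j \<zeta>)) * D \<zeta> = poly E (y i j \<zeta>) - poly E (z i \<zeta>)" for \<zeta>
    proof -
      have "(poly S (y i j \<zeta>) + d)\<^sup>2 + poly E (y i j \<zeta>) = (- poly S (z i \<zeta>) + d)\<^sup>2 + poly E (z i \<zeta>)"
        using y[of i j \<zeta>] by (simp only: p S E)
      then have "poly E (y i j \<zeta>) - poly E (z i \<zeta>) = (- poly S (z i \<zeta>) + d)\<^sup>2 - (poly S (y i j \<zeta>) + d)\<^sup>2"
        by algebra
      then show ?thesis
        by (simp add: D_def power2_eq_square algebra_simps)
    qed
    show "((\<lambda>\<zeta>. (1 * (case k of (i, j) \<Rightarrow> \<lambda>\<zeta>. poly p (- y i j \<zeta>)) \<zeta> / (a * \<zeta> ^ (2 * l)) - 1)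
        * \<zeta> ^ (3 * l - e)) \<longlongrightarrow> K k) at_infinity"
    proof (rule tendsto_cong[THEN iffD1])
      have "((\<lambda>\<zeta>. - 4 * d * (poly E (y i j \<zeta>) / \<zeta> ^ e - poly E (z i \<zeta>) / \<zeta> ^ e) / (a * (D \<zeta> / \<zeta> ^ l)))
          \<longlongrightarrow> - 4 * d * (\<epsilon> * \<mu> ^ j - \<epsilon> * \<mu> ^ i) / (a * (2 * b))) at_infinity"
        using a b by (intro tendsto_intros Ey Ez D_lim) auto
      moreover have "- 4 * d * (\<epsilon> * \<mu> ^ j - \<epsilon> * \<mu> ^ i) / (a * (2 * b)) = K k"
        using a b by (simp add: K_def k X_def field_simps)
      ultimately show "((\<lambda>\<zeta>. - 4 * d * (poly E (y i j \<zeta>) / \<zeta> ^ e - poly E (z i \<zeta>) / \<zeta> ^ e)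
          / (a * (D \<zeta> / \<zeta> ^ l))) \<longlongrightarrow> K k) at_infinity"
        by simp
      show "\<forall>\<^sub>F \<zeta> in at_infinity. - 4 * d * (poly E (y i j \<zeta>) / \<zeta> ^ e - poly E (z i \<zeta>) / \<zeta> ^ e)
          / (a * (D \<zeta> / \<zeta> ^ l))
          = (1 * (case k of (i, j) \<Rightarrow> \<lambda>\<zeta>. poly p (- y i j \<zeta>)) \<zeta> / (a * \<zeta> ^ (2 * l)) - 1) * \<zeta> ^ (3 * l - e)"
        using D_ne eventually_not_equal_at_infinity[of 0]
      proof eventually_elim
        case (elim \<zeta>)
        define T where "T = poly S (z i \<zeta>) + poly S (y i j \<zeta>)"
        have D: "D \<zeta> \<noteq> 0"
          using elim by auto
        have pow: "\<zeta> ^ l * \<zeta> ^ (2 * l) = \<zeta> ^ e * \<zeta> ^ (3 * l - e)"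
          using le by (simp flip: power_add)
        have "- 4 * d * (poly E (y i j \<zeta>) / \<zeta> ^ e - poly E (z i \<zeta>) / \<zeta> ^ e) / (a * (D \<zeta> / \<zeta> ^ l))
            = - 4 * d * (T * D \<zeta>) / \<zeta> ^ e / (a * (D \<zeta> / \<zeta> ^ l))"
          unfolding T_def SD by (simp flip: diff_divide_distrib)
        also have "\<dots> = - 4 * d * T * \<zeta> ^ l / (a * \<zeta> ^ e)"
          using D elim a by (simp add: field_simps)
        also have "\<dots> = - 4 * d * T / (a * \<zeta> ^ (2 * l)) * \<zeta> ^ (3 * l - e)"
          using elim a pow by (simp add: frac_eq_eq)
        also have "- 4 * d * T / (a * \<zeta> ^ (2 * l)) = poly p (- y i j \<zeta>) / (a * \<zeta> ^ (2 * l)) - 1"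
          unfolding T_def defect[symmetric] using elim a by (simp add: diff_divide_distrib)
        finally show ?case
          by (simp add: k)
      qed
    qed
  qed (use le a f in auto)
qed

section \<open>Parity of exponents, and the entire cosine of a square root\<close>

text \<open>Applied to leading coefficients, this reads the parity of a degree off the symmetry of
  the polynomial.\<close>

lemma power_uminus_one_eq_if_coeff_nonzero:
  fixes p :: "complex poly"
  assumes "\<And>z. poly p (- z) = c * poly p z" "coeff p i \<noteq> 0"
  shows "(- 1) ^ i = c"
proof -
  have "pcompose p [:0, - 1:] = smult c p"
    by (rule poly_ext) (simp add: poly_pcompose assms(1))
  then have "(- 1) ^ i * coeff p i = c * coeff p i"
    by (metis coeff_pcompose_linear coeff_smult)
  then show ?thesis
    using assms(2) by simp
qed

text \<open>Cosine is even, so the choice of square root is immaterial. The principal root is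
  holomorphic off the nonpositive axis and \<open>\<i> * csqrt (- w)\<close> off the nonnegative
  axis; the remaining point \<open>0\<close> is removable by continuity.\<close>

lemma holomorphic_cos_csqrt: "(\<lambda>w. cos (c * csqrt w)) holomorphic_on UNIV"
proof (rule no_isolated_singularity[where K = "{0}"])
  have sq: "cos (c * u) = cos (c * v)" if "u\<^sup>2 = v\<^sup>2" for u v
    using that by (auto simp: power2_eq_iff)
  have neg: "cos (c * csqrt w) = cos (c * (\<i> * csqrt (- w)))" for w
    by (rule sq) (simp add: power_mult_distrib)
  have pos_hol: "(\<lambda>w. cos (c * csqrt w)) holomorphic_on - \<real>\<^sub>\<le>\<^sub>0"
    by (intro holomorphic_intros) auto
  have "(\<lambda>w. cos (c * (\<i> * csqrt (- w)))) holomorphic_on - \<real>\<^sub>\<ge>\<^sub>0"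
    by (intro holomorphic_intros) (auto simp: complex_nonpos_Reals_iff complex_nonneg_Reals_iff)
  then have neg_hol: "(\<lambda>w. cos (c * csqrt w)) holomorphic_on - \<real>\<^sub>\<ge>\<^sub>0"
    by (simp only: neg[symmetric])
  have "- \<real>\<^sub>\<le>\<^sub>0 \<union> - \<real>\<^sub>\<ge>\<^sub>0 = UNIV - {0::complex}"
    by (auto simp: complex_nonpos_Reals_iff complex_nonneg_Reals_iff complex_eq_iff)
  then show hol: "(\<lambda>w. cos (c * csqrt w)) holomorphic_on UNIV - {0}"
    using holomorphic_on_Un[OF pos_hol neg_hol] by (simp add: open_Compl)
  show "continuous_on UNIV (\<lambda>w. cos (c * csqrt w))"
    unfolding continuous_on_eq_continuous_at[OF open_UNIV]
  proof
    fix w :: complex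
    show "isCont (\<lambda>w. cos (c * csqrt w)) w"
    proof (cases "w = 0")
      case True
      have "isCont csqrt 0"
      proof -
        have "((\<lambda>w::complex. sqrt (norm w)) \<longlongrightarrow> sqrt (norm (0::complex))) (at 0)"
          by (intro tendsto_intros)
        then have "(csqrt \<longlongrightarrow> 0) (at 0)"
          by (subst tendsto_norm_zero_iff[symmetric]) (simp add: norm_csqrt)
        then show ?thesis
          by (simp add: isCont_def)
      qed
      then show ?thesis
        using True by (intro continuous_intros) auto
    next
      case False
      moreover have "open (UNIV - {0::complex})"
        by (intro open_delete open_UNIV)
      ultimately show ?thesis
        using holomorphic_on_imp_continuous_on[OF hol] by (auto simp: continuous_on_eq_continuous_at)
    qed
  qed
qed auto

section \<open>From an even composition to the three forms\<close>

lemma parity_forms_if_even_composition: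
  fixes p :: "complex poly"
  assumes f: "f holomorphic_on UNIV" and nonconst: "\<not> f constant_on UNIV"
    and even: "\<And>z. f (poly p (- z)) = f (poly p z)"
    and p0: "poly p 0 = 0"
  shows "(\<forall>z. poly p (- z) = poly p z) \<or> (\<forall>z. poly p (- z) = - poly p z) \<or>
    (\<exists>S d k. (\<forall>z. poly S (- z) = - poly S z) \<and> d \<noteq> 0 \<and> (\<forall>z. poly p z = (poly S z + d)\<^sup>2 + k))"
proof -
  define \<alpha> :: complex where "\<alpha> = (- 1) ^ degree p"
  define r where "r = pcompose p [:0, - 1:] - smult \<alpha> p"
  have r: "poly p (- z) = \<alpha> * poly p z + poly r z" for z
    by (simp add: r_def poly_pcompose)
  have \<alpha>: "\<alpha> = 1 \<or> \<alpha> = - 1"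
    unfolding \<alpha>_def by (rule minus_one_power_iff[THEN ssubst]) auto
  show ?thesis
  proof (cases "r = 0")
    case True
    then show ?thesis
      using r \<alpha> by auto
  next
    case False
    define l where "l = degree r"
    have coeff_r: "coeff r i = ((- 1) ^ i - \<alpha>) * coeff p i" for i
      by (simp add: r_def coeff_pcompose_linear algebra_simps)
    have l_coeff: "coeff r l \<noteq> 0"
      using False by (simp add: l_def)
    \<comment> \<open>In \<open>coeff_r\<close> the first factor vanishes at
      \<open>i = degree p\<close>. At \<open>i = 0\<close> the second vanishes by \<open>p0\<close>,
      whence \<open>l > 0\<close> below.\<close>
    then have "l \<le> degree p" "l \<noteq> degree p"
      using le_degree by (auto simp: coeff_r \<alpha>_def)
    then have "l < degree p"
      by simp
    moreover have "l > 0"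
      using l_coeff p0 by (cases l) (auto simp: coeff_r poly_0_coeff_0)
    ultimately have l: "0 < l" "2 * l = degree p"
      using degree_parity_defect[OF f nonconst even r] \<alpha> by (auto simp: l_def)
    have \<alpha>1: "\<alpha> = 1"
      by (simp add: \<alpha>_def flip: l(2))
    have r_odd: "poly r (- z) = - 1 * poly r z" for z
      using r[of z] r[of "- z"] by (simp add: \<alpha>1 eq_neg_iff_add_eq_0 add.commute)
    have "odd l"
      using power_uminus_one_eq_if_coeff_nonzero[OF r_odd l_coeff] by (metis neg_one_even_power one_neq_neg_one)
    define a o' where "a = lead_coeff p" and "o' = lead_coeff r"
    have a: "a \<noteq> 0" and o': "o' \<noteq> 0"
      using l False by (auto simp: a_def o'_def)
    define b where "b = csqrt a"
    have b: "b\<^sup>2 = a" "b \<noteq> 0"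
      using a by (auto simp: b_def)
    \<comment> \<open>Completing the square: the odd part of \<open>p\<close> is
      \<open>- r / 2\<close>. The scaling gives \<open>S\<close> the leading coefficient
      \<open>b\<close>, so its square has the leading term of \<open>p\<close>, and \<open>d\<close>
      is chosen so that \<open>2 * d * S\<close> is that odd part. What remains is even of smaller
      degree.\<close>
    define S where "S = smult (b / o') r"
    define d where "d = - o' / (4 * b)"
    have d: "d \<noteq> 0"
      using b o' by (simp add: d_def)
    have S_odd: "poly S (- z) = - poly S z" for z
      using r_odd by (simp add: S_def)
    have deg_S: "degree S = l"
      using b o' by (simp add: S_def l_def)
    define E0 where "E0 = p - (S + [:d:])\<^sup>2"
    define k where "k = poly E0 0"
    define E where "E = E0 - [:k:]"
    have E: "poly p z = (poly S z + d)\<^sup>2 + k + poly E z" for z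
      by (simp add: E_def E0_def)
    have "4 * d * poly S z = - poly r z" for z
      using b o' by (simp add: S_def d_def)
    then have E_even: "poly E (- z) = 1 * poly E z" for z
      using r[of z] by (simp add: E_def E0_def S_odd \<alpha>1 power2_eq_square algebra_simps)
    show ?thesis
    proof (cases "E = 0")
      case True
      then have "\<forall>z. poly p z = (poly S z + d)\<^sup>2 + k"
        using E by simp
      then show ?thesis
        using S_odd d by blast
    next
      case False
      have "poly E 0 = 0"
        by (simp add: E_def k_def)
      have "degree E > 0"
      proof (rule ccontr)
        assume "\<not> degree E > 0"
        then obtain c where "E = [:c:]"
          by (auto elim: degree_eq_zeroE)
        then show False
          using False \<open>poly E 0 = 0\<close> by auto
      qed
      have deg_Sd: "degree (S + [:d:]) = l"
        using deg_S l by (simp add: degree_add_eq_left)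
      then have deg_sq: "degree ((S + [:d:])\<^sup>2) = 2 * l"
        using l by (subst degree_power_eq) auto
      have "coeff (S + [:d:]) l = b"
        using o' l by (simp add: S_def o'_def l_def coeff_pCons split: nat.splits)
      then have "coeff ((S + [:d:])\<^sup>2) (2 * l) = a"
        using lead_coeff_power[of "S + [:d:]" 2] deg_sq deg_Sd b by simp
      then have "coeff E (2 * l) = 0"
        using l by (simp add: E_def E0_def a_def coeff_pCons split: nat.splits)
      then have "degree E \<noteq> 2 * l"
        using False by (metis leading_coeff_0_iff)
      moreover have "degree E \<le> 2 * l"
        unfolding E_def E0_def using deg_sq l by (intro degree_diff_le) auto
      ultimately have "degree E < 2 * l"
        by simp
      have "(- 1) ^ degree E = (1::complex)"
        using False by (intro power_uminus_one_eq_if_coeff_nonzero[OF E_even]) auto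
      then have "even (degree E)"
        by (metis neg_one_odd_power one_neq_neg_one)
      define g where "g = (\<lambda>w. f (w + k))"
      define p1 where "p1 = p - [:k:]"
      have "f \<circ> (\<lambda>w. w + k) holomorphic_on UNIV"
        using f by (intro holomorphic_on_compose holomorphic_intros) (auto intro: holomorphic_on_subset)
      then have "g holomorphic_on UNIV"
        by (simp add: g_def o_def)
      moreover have "degree p1 = 2 * l"
        unfolding p1_def using l by (simp add: diff_conv_add_uminus degree_add_eq_left del: add_uminus_conv_diff)
      moreover have "poly p1 z = (poly S z + d)\<^sup>2 + poly E z" for z
        by (simp add: p1_def E)
      moreover have "g (poly p1 (- z)) = g (poly p1 z)" for z
        using even by (simp add: g_def p1_def)
      ultimately have "g constant_on UNIV"
        using constant_if_square_perturbed[of g p1 S d E] d S_odd E_even deg_S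
          \<open>odd l\<close> \<open>even (degree E)\<close> \<open>degree E > 0\<close> \<open>degree E < 2 * l\<close>
        by (simp del: poly_minus)
      then have "f constant_on UNIV"
        unfolding constant_on_def g_def by (metis UNIV_I diff_add_cancel)
      then show ?thesis
        using nonconst by blast
    qed
  qed
qed

section \<open>The characterisation in both directions\<close>

theorem theorem2:
  fixes p :: "complex poly"
  shows "(\<exists>f :: complex \<Rightarrow> complex.
            f holomorphic_on UNIV \<and> \<not> f constant_on UNIV \<and> even_fun (f \<circ> poly p)) \<longleftrightarrow>
         (even_fun (poly p)
          \<or> (\<exists>(s :: complex poly) (k :: complex).
                odd_fun (poly s) \<and> (\<forall>z. poly p z = poly s z + k))
          \<or> (\<exists>(s :: complex poly) (d :: complex) (k :: complex).
                odd_fun (poly s) \<and> d \<noteq> 0 \<and> (\<forall>z. poly p z = (poly s z + d)\<^sup>2 + k)))"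
    (is "?L \<longleftrightarrow> ?A \<or> ?B \<or> ?C")
proof
  assume ?L
  then obtain f where f: "f holomorphic_on UNIV" "\<not> f constant_on UNIV"
      and even: "\<And>z. f (poly p (- z)) = f (poly p z)"
    by (auto simp: even_fun_def)
  \<comment> \<open>Translation achieves the normalisation \<open>q 0 = 0\<close>; afterwards
    \<open>m\<close> is absorbed into the additive constant.\<close>
  define m where "m = poly p 0"
  define g where "g = (\<lambda>w. f (w + m))"
  define q where "q = p - [:m:]"
  have q: "poly p z = poly q z + m" for z
    by (simp add: q_def)
  have "f \<circ> (\<lambda>w. w + m) holomorphic_on UNIV"
    using f by (intro holomorphic_on_compose holomorphic_intros) (auto intro: holomorphic_on_subset)
  then have "g holomorphic_on UNIV"
    by (simp add: g_def o_def)
  moreover have "\<not> g constant_on UNIV"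
    using f(2) unfolding constant_on_def g_def by (metis UNIV_I diff_add_cancel)
  ultimately consider "\<And>z. poly q (- z) = poly q z" | "\<And>z. poly q (- z) = - poly q z"
    | S d k where "\<And>z. poly S (- z) = - poly S z" "d \<noteq> 0" "\<And>z. poly q z = (poly S z + d)\<^sup>2 + k"
    using parity_forms_if_even_composition[of g q] even by (auto simp: g_def q_def m_def)
  then show "?A \<or> ?B \<or> ?C"
  proof cases
    case 1
    then show ?thesis
      by (simp add: even_fun_def q)
  next
    case 2
    then have ?B
      using q by (auto simp: odd_fun_def)
    then show ?thesis
      by blast
  next
    case 3
    then have "odd_fun (poly S) \<and> d \<noteq> 0 \<and> (\<forall>z. poly p z = (poly S z + d)\<^sup>2 + (k + m))"
      by (simp add: odd_fun_def q)
    then show ?thesis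
      by blast
  qed
next
  assume "?A \<or> ?B \<or> ?C"
  then consider ?A | s k where "odd_fun (poly s)" "\<And>z. poly p z = poly s z + k"
    | s d k where "odd_fun (poly s)" "d \<noteq> 0" "\<And>z. poly p z = (poly s z + d)\<^sup>2 + k"
    by blast
  then show ?L
  proof cases
    case 1
    moreover have "\<not> (\<lambda>w::complex. w) constant_on UNIV"
      unfolding constant_on_def by (metis UNIV_I zero_neq_one)
    ultimately show ?thesis
      by (intro exI[of _ "\<lambda>w. w"]) (auto simp: o_def)
  next
    case (2 s k)
    let ?f = "\<lambda>w. (w - k)\<^sup>2"
    have "?f k \<noteq> ?f (k + 1)"
      by simp
    then have "\<not> ?f constant_on UNIV"
      unfolding constant_on_def by (metis UNIV_I)
    moreover have "?f holomorphic_on UNIV"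
      by (intro holomorphic_intros)
    moreover have "even_fun (?f \<circ> poly p)"
      using 2 by (simp add: even_fun_def odd_fun_def)
    ultimately show ?thesis
      by blast
  next
    case (3 s d k)
    \<comment> \<open>The factor \<open>pi / d\<close> turns the shift by \<open>d\<close> into a
      half period of cosine. Thus \<open>f (p z) = - cos (pi * s z / d)\<close>, which is even
      because \<open>s\<close> is odd.\<close>
    define h where "h = (\<lambda>w. cos (of_real pi / d * csqrt w))"
    define f where "f w = h (w - k)" for w
    have h_sq: "h (u\<^sup>2) = cos (of_real pi / d * u)" for u
    proof -
      have "csqrt (u\<^sup>2) = u \<or> csqrt (u\<^sup>2) = - u"
        by (metis power2_csqrt power2_eq_iff)
      then show ?thesis
        by (auto simp: h_def)
    qed
    have "h \<circ> (\<lambda>w. w - k) holomorphic_on UNIV"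
      using holomorphic_cos_csqrt[of "of_real pi / d"] unfolding h_def
      by (intro holomorphic_on_compose_gen[where t = UNIV]) (auto intro!: holomorphic_intros)
    then have "f holomorphic_on UNIV"
      by (simp add: f_def[abs_def] o_def)
    moreover have "f k = 1" "f (d\<^sup>2 + k) = - 1"
      using h_sq[of 0] h_sq[of d] 3(2) by (simp_all add: f_def flip: cos_of_real)
    then have "\<not> f constant_on UNIV"
      unfolding constant_on_def by (metis UNIV_I one_neq_neg_one)
    moreover have "f (poly p z) = - cos (of_real pi / d * poly s z)" for z
    proof -
      have "f (poly p z) = cos (of_real pi / d * poly s z + of_real pi)"
        using 3(2) by (simp add: f_def 3(3) h_sq distrib_left)
      then show ?thesis
        by (simp add: cos_add flip: cos_of_real sin_of_real)
    qed
    then have "even_fun (f \<circ> poly p)"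
      using 3(1) by (simp add: even_fun_def odd_fun_def)
    ultimately show ?thesis
      by blast
  qed
qed

end
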